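(* Let $\{M^n\}_{n\ge1}$, $M^n=(F^n,W^n,\alpha^n)$, be a sequence of unbalanced random assignment markets with $|F^n|=n$ firms and $|W^n|=n+k(n)$ workers, where $k(n)\ge1$ is an integer for each $n$ (so the workers form the long side), and where the entries of $\alpha^n$ are i.i.d. with cdf $G$ supported on $[0,1]$ having a density $g$ that is continuous and strictly positive on $[0,1]$. Then, with probability $1-O\left(\frac1n\right)$, under every core allocation of $M^n$ all agents on the long side get a payoff $O\left(\frac{\log^2(n)}{n}\right)$, and the long side's share of the surplus is $O\left(\frac{\log^2(n)}{n}\right)$ as well.
   Context: A market is $M^n=(F^n,W^n,\alpha^n)$, where $F^n$ is a finite set of firms, $W^n$ a finite set of workers, and $\alpha^n$ is an $|F^n|\times|W^n|$ real matrix; $\alpha^n_{f,w}$ is the value produced by the pair $(f,w)$. The value of a coalition $S\subseteq F^n\cup W^n$ is $\mathrm{v}(S)=\max[\alpha^n_{i_1j_1}+\dots+\alpha^n_{i_lj_l}]$, the maximum over all choices of $2l$ distinct agents $i_1,\dots,i_l\in S\cap F^n$, $j_1,\dots,j_l\in S\cap W^n$, $l\le\min\{|S\cap F^n|,|S\cap W^n|\}$. An allocation is a triple $(\mu,u,v)$, where $\mu$ is a (one-to-one, possibly partial) matching of firms and workers, and $u=(u_f)_{f\in F^n}$ (profits) and $v=(v_w)_{w\in W^n}$ (salaries) are real payoff vectors. Utility is linear in money and transfers between any agents are allowed, so feasibility means $\sum_f u_f+\sum_w v_w=\sum_{f:\mu(f)\ne\emptyset}\alpha^n_{f,\mu(f)}$.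 It is a core allocation if no coalition can deviate and split its value so that all its members become strictly better off, i.e. $\sum_{f\in S\cap F^n}u_f+\sum_{w\in S\cap W^n}v_w\ge \mathrm{v}(S)$ for every coalition $S$. (Equivalently: $u,v\ge0$, $u_f+v_w\ge\alpha^n_{f,w}$ for all $f,w$, with equality for matched pairs, and unmatched agents get $0$.) The long side's share of the surplus is $\sum_w v_w/\mathrm{v}(F^n\cup W^n)$, the sum of the payoffs of the long side (the workers) divided by the total surplus. The $O(\cdot)$'s are as $n\to\infty$, with implied constants independent of $n$, of the core allocation and of the agent (and non-random). *)

theory Defs
  imports "HOL-Probability.Probability" "HOL-Library.Landau_Symbols"
begin

text \<open>
  Firms and workers live in separate types, so a coalition is given by its set \<open>A\<close> of firms together
  with its set \<open>B\<close> of workers.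
\<close>

definition matching :: "'f set \<Rightarrow> 'w set \<Rightarrow> ('f \<times> 'w) set \<Rightarrow> bool" where
  "matching A B \<mu> \<longleftrightarrow> \<mu> \<subseteq> A \<times> B \<and> inj_on fst \<mu> \<and> inj_on snd \<mu>"

definition matching_value :: "('f \<Rightarrow> 'w \<Rightarrow> real) \<Rightarrow> ('f \<times> 'w) set \<Rightarrow> real" where
  "matching_value a \<mu> = (\<Sum>(f, w)\<in>\<mu>. a f w)"

text \<open>
  The empty matching is admitted, so coalitions consisting of firms only or of workers only have
  value \<open>0\<close>, and no coalition of finite sets has negative value.
\<close>

definition coalition_value :: "('f \<Rightarrow> 'w \<Rightarrow> real) \<Rightarrow> 'f set \<Rightarrow> 'w set \<Rightarrow> real" where
  "coalition_value a A B = Max {matching_value a \<mu> | \<mu>. matching A B \<mu>}"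

lemma
  assumes "finite A" "finite B"
  shows finite_matching_values: "finite {matching_value a \<mu> | \<mu>. matching A B \<mu>}"
    and matching_values_nonempty: "{matching_value a \<mu> | \<mu>. matching A B \<mu>} \<noteq> {}"
proof -
  have "{\<mu>. matching A B \<mu>} \<subseteq> Pow (A \<times> B)"
    by (auto simp: matching_def)
  then have "finite {\<mu>. matching A B \<mu>}"
    using assms by (meson finite_Pow_iff finite_SigmaI finite_subset)
  then show "finite {matching_value a \<mu> | \<mu>. matching A B \<mu>}"
    by simp
  have "matching A B {}"
    by (simp add: matching_def)
  then show "{matching_value a \<mu> | \<mu>. matching A B \<mu>} \<noteq> {}"
    by blast
qed

definition allocation ::
    "'f set \<Rightarrow> 'w set \<Rightarrow> ('f \<Rightarrow> 'w \<Rightarrow> real) \<Rightarrow> ('f \<times> 'w) set \<Rightarrow> ('f \<Rightarrow> real) \<Rightarrow> ('w \<Rightarrow> real) \<Rightarrow> bool" where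
  "allocation F W a \<mu> u v \<longleftrightarrow>
     matching F W \<mu> \<and> (\<Sum>f\<in>F. u f) + (\<Sum>w\<in>W. v w) = matching_value a \<mu>"

definition core_allocation ::
    "'f set \<Rightarrow> 'w set \<Rightarrow> ('f \<Rightarrow> 'w \<Rightarrow> real) \<Rightarrow> ('f \<times> 'w) set \<Rightarrow> ('f \<Rightarrow> real) \<Rightarrow> ('w \<Rightarrow> real) \<Rightarrow> bool" where
  "core_allocation F W a \<mu> u v \<longleftrightarrow>
     allocation F W a \<mu> u v \<and>
     (\<forall>A B. A \<subseteq> F \<longrightarrow> B \<subseteq> W \<longrightarrow> (\<Sum>f\<in>A. u f) + (\<Sum>w\<in>B. v w) \<ge> coalition_value a A B)"

definition worker_share ::
    "'f set \<Rightarrow> 'w set \<Rightarrow> ('f \<Rightarrow> 'w \<Rightarrow> real) \<Rightarrow> ('w \<Rightarrow> real) \<Rightarrow> real" where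
  "worker_share F W a v = (\<Sum>w\<in>W. v w) / coalition_value a F W"

end

theory Submission
  imports Defs "HOL-Real_Asymp.Real_Asymp"
begin

text \<open>
  Call a pair \<open>(f, w)\<close> good if \<open>\<alpha> f w \<ge> 1 - d\<close>, where \<open>d\<close> is a large multiple of \<open>ln n / n\<close>. If
  worker \<open>w\<close> is matched to \<open>f\<close> in a core allocation and \<open>(f, w')\<close> is good, then
  \<open>v w' \<ge> \<alpha> f w' - u f \<ge> v w - d\<close>. So with \<open>H j = {w'. v w' \<ge> v w - j d}\<close> no firm matched into \<open>H j\<close>
  forms a good pair with a worker outside \<open>H (j + 1)\<close>. With probability \<open>1 - O(1/n)\<close> the random
  bipartite graph of good pairs expands: \<open>H j\<close> doubles until it has \<open>n/4\<close> elements, then in one step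
  its complement has at most \<open>n/4\<close> elements, and from then on the complement halves. Hence \<open>O(ln n)\<close> steps
  exhaust all workers; as some worker is unmatched and has salary \<open>0\<close>, \<open>v w\<close> is at most
  \<open>O(ln n) d\<close>. Every firm is in a good pair, so its profit is at least \<open>1/2\<close>, and the total surplus is
  at least \<open>n/2\<close>, while at most \<open>n\<close> workers have a positive salary.
\<close>

section \<open>Payoffs in a core allocation\<close>

lemma coalition_value_ge:
  assumes "finite A" "finite B" "matching A B \<mu>"
  shows "matching_value a \<mu> \<le> coalition_value a A B"
  unfolding coalition_value_def
  by (rule Max_ge) (use assms finite_matching_values in auto)

lemma core_allocation_coalition_ge:
  assumes "core_allocation F W a \<mu> u v" "finite F" "finite W" "A \<subseteq> F" "B \<subseteq> W" "matching A B \<nu>"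
  shows "matching_value a \<nu> \<le> sum u A + sum v B"
  using assms coalition_value_ge[of A B \<nu> a] finite_subset
  unfolding core_allocation_def by (metis order_trans)

text \<open>Three small coalitions that may block: one firm, one worker, and a pair that may form
  its own match.\<close>

lemma
  assumes core: "core_allocation F W a \<mu> u v" and fin: "finite F" "finite W"
  shows core_firm_nonneg: "f \<in> F \<Longrightarrow> 0 \<le> u f"
    and core_worker_nonneg: "w \<in> W \<Longrightarrow> 0 \<le> v w"
    and core_pair_ge: "f \<in> F \<Longrightarrow> w \<in> W \<Longrightarrow> a f w \<le> u f + v w"
proof -
  show "0 \<le> u f" if "f \<in> F"
    using core_allocation_coalition_ge[OF core fin, of "{f}" "{}" "{}"] that
    by (simp add: matching_def matching_value_def)
  show "0 \<le> v w" if "w \<in> W"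
    using core_allocation_coalition_ge[OF core fin, of "{}" "{w}" "{}"] that
    by (simp add: matching_def matching_value_def)
  show "a f w \<le> u f + v w" if "f \<in> F" "w \<in> W"
    using core_allocation_coalition_ge[OF core fin, of "{f}" "{w}" "{(f, w)}"] that
    by (simp add: matching_def matching_value_def)
qed

text \<open>The payoffs of unmatched agents and the slacks \<open>u f + v w - a f w\<close> of
  matched pairs are nonnegative, and feasibility makes their total zero; hence each of them
  vanishes.\<close>

lemma
  assumes core: "core_allocation F W a \<mu> u v" and fin: "finite F" "finite W"
  shows core_matched_eq: "(f, w) \<in> \<mu> \<Longrightarrow> u f + v w = a f w"
    and core_unmatched_worker: "w \<in> W - snd ` \<mu> \<Longrightarrow> v w = 0"
proof -
  have mat: "\<mu> \<subseteq> F \<times> W" "inj_on fst \<mu>" "inj_on snd \<mu>"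
    and feas: "sum u F + sum v W = (\<Sum>(f, w)\<in>\<mu>. a f w)"
    using core by (auto simp: core_allocation_def allocation_def matching_def matching_value_def)
  have fin\<mu>: "finite \<mu>" using mat fin finite_subset by blast
  let ?r = "\<lambda>(f, w). u f + v w - a f w"
  have sub: "fst ` \<mu> \<subseteq> F" "snd ` \<mu> \<subseteq> W" using mat by auto
  have "sum u F = sum u (F - fst ` \<mu>) + (\<Sum>e\<in>\<mu>. u (fst e))"
    using sum.subset_diff[OF sub(1) fin(1), of u] sum.reindex[OF mat(2), of u] by (simp add: o_def)
  moreover have "sum v W = sum v (W - snd ` \<mu>) + (\<Sum>e\<in>\<mu>. v (snd e))"
    using sum.subset_diff[OF sub(2) fin(2), of v] sum.reindex[OF mat(3), of v] by (simp add: o_def)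
  moreover have "sum ?r \<mu> = (\<Sum>e\<in>\<mu>. u (fst e)) + (\<Sum>e\<in>\<mu>. v (snd e)) - (\<Sum>(f, w)\<in>\<mu>. a f w)"
    by (simp add: sum.distrib sum_subtractf case_prod_beta)
  ultimately have eq: "sum u (F - fst ` \<mu>) + sum v (W - snd ` \<mu>) + sum ?r \<mu> = 0"
    using feas by simp
  have nn: "\<forall>e\<in>\<mu>. 0 \<le> ?r e"
    using mat(1) core_pair_ge[OF core fin] by fastforce
  have n1: "0 \<le> sum u (F - fst ` \<mu>)"
    by (rule sum_nonneg) (use core_firm_nonneg[OF core fin] in auto)
  have n2: "0 \<le> sum v (W - snd ` \<mu>)"
    by (rule sum_nonneg) (use core_worker_nonneg[OF core fin] in auto)
  have n3: "0 \<le> sum ?r \<mu>"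
    by (rule sum_nonneg) (use nn in auto)
  have "sum ?r \<mu> = 0" using eq n1 n2 n3 by linarith
  then show "u f + v w = a f w" if "(f, w) \<in> \<mu>"
    using sum_nonneg_eq_0_iff[OF fin\<mu>, of ?r] nn that by fastforce
  have "sum v (W - snd ` \<mu>) = 0" using eq n1 n2 n3 by linarith
  then show "v w = 0" if "w \<in> W - snd ` \<mu>"
    using sum_nonneg_eq_0_iff[of "W - snd ` \<mu>" v] core_worker_nonneg[OF core fin] fin that by auto
qed

section \<open>Expansion of the graph of good pairs and its effect on payoffs\<close>

text \<open>Absence of an empty \<open>s\<close> by \<open>t\<close> rectangle: expansion in a form
  made for the union bound. Exact sizes reduce the count of rectangles to two binomial coefficients;
  larger sets are handled by passing to subsets.\<close>

definition linked :: "'f set \<Rightarrow> 'w set \<Rightarrow> ('f \<Rightarrow> 'w \<Rightarrow> bool) \<Rightarrow> nat \<Rightarrow> nat \<Rightarrow> bool" where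
  "linked F W R s t \<longleftrightarrow>
     (\<forall>S T. S \<subseteq> F \<longrightarrow> T \<subseteq> W \<longrightarrow> card S = s \<longrightarrow> card T = t \<longrightarrow> (\<exists>f\<in>S. \<exists>w\<in>T. R f w))"

lemma linkedD:
  assumes "linked F W R s t" "S \<subseteq> F" "T \<subseteq> W" "s \<le> card S" "t \<le> card T"
  shows "\<exists>f\<in>S. \<exists>w\<in>T. R f w"
proof -
  obtain S' where "S' \<subseteq> S" "card S' = s" using assms(4) obtain_subset_with_card_n by metis
  moreover obtain T' where "T' \<subseteq> T" "card T' = t" using assms(5) obtain_subset_with_card_n by metis
  ultimately have "\<exists>f\<in>S'. \<exists>w\<in>T'. R f w" "S' \<subseteq> S" "T' \<subseteq> T"
    using assms(1-3) unfolding linked_def by auto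
  then show ?thesis by blast
qed

text \<open>
  The three families say: at most a quarter of the firms have more than twice as many neighbours
  as members; a quarter of the firms miss fewer than \<open>max (n/4) k\<close> workers; and \<open>t \<le> n/4\<close>
  workers have more than \<open>2t\<close> neighbours. Only \<open>t \<ge> k\<close> is asked for in the last one, because the
  union bound over sets of \<open>t\<close> workers fails when \<open>k\<close> is superpolynomial in \<open>n\<close>.
\<close>

definition critical_sizes :: "nat \<Rightarrow> nat \<Rightarrow> (nat \<times> nat) set" where
  "critical_sizes n k =
     (\<lambda>s. (s, n + k - 2 * s)) ` {1..n div 4}
     \<union> {((n + 3) div 4, max ((n + 3) div 4) k)}
     \<union> (\<lambda>t. (n - 2 * t, t)) ` {k..n div 4}"

lemma finite_critical_sizes: "finite (critical_sizes n k)"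
  by (simp add: critical_sizes_def)

text \<open>Each size will fail with probability at most \<open>1 / n^2\<close>, so a crude count of
  \<open>n\<close> gives total failure \<open>1 / n\<close>.\<close>

lemma card_critical_sizes_le:
  assumes "2 \<le> n" "1 \<le> k"
  shows "card (critical_sizes n k) \<le> n"
proof -
  have "card (critical_sizes n k) \<le> card ((\<lambda>s. (s, n + k - 2 * s)) ` {1..n div 4}) + 1
      + card ((\<lambda>t. (n - 2 * t, t)) ` {k..n div 4})"
    unfolding critical_sizes_def
    by (rule order_trans[OF card_Un_le add_mono[OF order_trans[OF card_Un_le]]]) auto
  also have "\<dots> \<le> card {1..n div 4} + 1 + card {k..n div 4}"
    by (intro add_mono card_image_le) auto
  also have "\<dots> \<le> n" using assms by auto
  finally show ?thesis .
qed

text \<open>The counting core of the salary bound: \<open>a j\<close> will be the size of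
  \<open>H j\<close> and \<open>m\<close> the number of workers. The \<open>2 * l + 1\<close> steps
  are \<open>l\<close> doublings, one middle step and \<open>l\<close> halvings of the
  complement.\<close>

lemma doubling_then_halving:
  fixes a :: "nat \<Rightarrow> nat"
  assumes a0: "1 \<le> a 0" and mono: "\<And>j. j < 2 * l + 1 \<Longrightarrow> a j \<le> a (Suc j)"
    and double: "\<And>j. j < 2 * l + 1 \<Longrightarrow> 1 \<le> a j \<Longrightarrow> 4 * a j \<le> n \<Longrightarrow> 2 * a j \<le> a (Suc j)"
    and middle: "\<And>j. j < 2 * l + 1 \<Longrightarrow> n < 4 * a j \<Longrightarrow> 4 * (m - a (Suc j)) \<le> n"
    and halve: "\<And>j. j < 2 * l + 1 \<Longrightarrow> 4 * (m - a (Suc j)) \<le> n \<Longrightarrow> 2 * (m - a (Suc j)) \<le> m - a j"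
    and l: "n < 2 ^ l"
  shows "m \<le> a (2 * l + 1)"
proof -
  have up: "2 ^ j \<le> a j \<or> n < 4 * a j" if "j \<le> 2 * l + 1" for j
    using that
  proof (induction j)
    case (Suc j)
    then have "2 ^ j \<le> a j \<or> n < 4 * a j" and j: "j < 2 * l + 1" by auto
    then show ?case
    proof (cases "n < 4 * a j")
      case False
      with \<open>2 ^ j \<le> a j \<or> n < 4 * a j\<close> have "2 ^ j \<le> a j" by auto
      moreover from this have "1 \<le> a j" by (meson one_le_numeral one_le_power order_trans)
      ultimately show ?thesis using double[OF j] False by fastforce
    qed (use mono[OF j] in linarith)
  qed (use a0 in auto)
  \<comment> \<open>After \<open>l\<close> steps either alternative of \<open>up\<close> gives this,
    since \<open>n < 2 ^ l\<close>.\<close>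
  have large: "n < 4 * a j" if "l \<le> j" "j \<le> 2 * l + 1" for j
    using up[OF that(2)] l power_increasing[OF that(1), of "2 :: nat"] by linarith
  have down: "2 ^ i * (m - a (l + 1 + i)) \<le> n" if "i \<le> l" for i
    using that
  proof (induction i)
    case 0
    then show ?case using middle[of l] large[of l] by auto
  next
    case (Suc i)
    \<comment> \<open>The set stays above a quarter of \<open>n\<close>, so \<open>middle\<close>
      applies again at each step and supplies the premise of \<open>halve\<close>.\<close>
    have "4 * (m - a (Suc (l + 1 + i))) \<le> n"
      using middle[of "l + 1 + i"] large[of "l + 1 + i"] Suc.prems by auto
    then have "2 * (m - a (Suc (l + 1 + i))) \<le> m - a (l + 1 + i)"
      using halve[of "l + 1 + i"] Suc.prems by auto
    then have "2 ^ i * (2 * (m - a (Suc (l + 1 + i)))) \<le> 2 ^ i * (m - a (l + 1 + i))"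
      by (rule mult_left_mono) auto
    also have "\<dots> \<le> n" using Suc by simp
    finally show ?case by (simp add: mult_ac)
  qed
  have "2 ^ l * (m - a (2 * l + 1)) < 2 ^ l * 1"
    using le_less_trans[OF down[OF order_refl] l] by (simp add: mult_2)
  then have "m - a (2 * l + 1) < 1" by (rule mult_less_cancel1[THEN iffD1, THEN conjunct2])
  then show ?thesis by auto
qed

text \<open>By contradiction: if \<open>v w\<close> exceeds the bound, all thresholds
  \<open>v w - j * d\<close> up to \<open>j = 2 * l + 1\<close> are positive, so every
  \<open>H j\<close> consists of matched workers and has at most \<open>n\<close> elements.
  Expansion makes the last one contain all \<open>n + k\<close> workers.\<close>

lemma core_worker_le:
  assumes core: "core_allocation F W a \<mu> u v" and fin: "finite F" "finite W"
    and card: "card F = n" "card W = n + k" "1 \<le> k"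
    and le1: "\<And>f w. f \<in> F \<Longrightarrow> w \<in> W \<Longrightarrow> a f w \<le> 1"
    and linked: "\<And>s t. (s, t) \<in> critical_sizes n k \<Longrightarrow> linked F W (\<lambda>f w. 1 - d \<le> a f w) s t"
    and d: "0 \<le> d" and l: "n < 2 ^ l" and w: "w \<in> W"
  shows "v w \<le> real (2 * l + 1) * d"
proof (rule ccontr)
  assume "\<not> ?thesis"
  then have big: "real (2 * l + 1) * d < v w" by simp
  have mat: "\<mu> \<subseteq> F \<times> W" "inj_on fst \<mu>" "inj_on snd \<mu>"
    using core by (auto simp: core_allocation_def allocation_def matching_def)
  define H where "H j = {w' \<in> W. v w - real j * d \<le> v w'}" for j
  define P where "P j = {e \<in> \<mu>. snd e \<in> H j}" for j
  define S where "S j = fst ` P j" for j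
  have HW: "H j \<subseteq> W" for j by (auto simp: H_def)
  have finH: "finite (H j)" for j using HW fin finite_subset by blast
  have SF: "S j \<subseteq> F" for j using mat by (auto simp: S_def P_def)
  have matched: "H j = snd ` P j" if "j \<le> 2 * l + 1" for j
  proof -
    have "real j * d \<le> real (2 * l + 1) * d" using that d by (intro mult_right_mono) auto
    then have "v w' > 0" if "w' \<in> H j" for w' using that big by (auto simp: H_def)
    then have "H j \<subseteq> snd ` \<mu>"
      using core_unmatched_worker[OF core fin] HW[of j] by fastforce
    then show ?thesis by (auto simp: P_def)
  qed
  have cardS: "card (S j) = card (H j)" if "j \<le> 2 * l + 1" for j
  proof -
    have "inj_on fst (P j)" "inj_on snd (P j)"
      using mat(2,3) by (auto simp: P_def intro: inj_on_subset)
    then show ?thesis by (simp add: S_def matched[OF that] card_image)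
  qed
  have cardHn: "card (H j) \<le> n" if "j \<le> 2 * l + 1" for j
    using cardS[OF that] card_mono[OF fin(1) SF[of j]] card(1) by simp
  have cardT: "card (W - H j) = n + k - card (H j)" for j
    using card_Diff_subset[OF finH HW] card(2) by simp
  have nolink: "\<not> (\<exists>f\<in>S j. \<exists>w'\<in>W - H (Suc j). 1 - d \<le> a f w')" for j
  proof clarify
    fix f w' assume f: "f \<in> S j" and w': "w' \<in> W" "w' \<notin> H (Suc j)" and edge: "1 - d \<le> a f w'"
    from f obtain w1 where w1: "(f, w1) \<in> \<mu>" "w1 \<in> H j" by (auto simp: S_def P_def)
    have fF: "f \<in> F" "w1 \<in> W" using w1 mat by auto
    have "u f + v w1 \<le> 1" using core_matched_eq[OF core fin w1(1)] le1[OF fF] by simp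
    moreover have "v w - real j * d \<le> v w1" using w1 by (simp add: H_def)
    moreover have "a f w' \<le> u f + v w'" using core_pair_ge[OF core fin fF(1) w'(1)] .
    ultimately have "v w - real j * d - d \<le> v w'" using edge by linarith
    then show False using w' by (simp add: H_def algebra_simps)
  qed
  \<comment> \<open>A large \<open>H j\<close> and a large complement of \<open>H (Suc j)\<close>
    exclude each other; each family of critical sizes turns this into one growth hypothesis.\<close>
  have separated: "\<not> (s \<le> card (H j) \<and> t \<le> n + k - card (H (Suc j)))"
    if "(s, t) \<in> critical_sizes n k" "j < 2 * l + 1" for s t j
    using linkedD[OF linked[OF that(1)] SF, of "W - H (Suc j)" j] nolink[of j] cardS[of j] cardT that(2)
    by auto
  have "n + k \<le> card (H (2 * l + 1))"
  proof (rule doubling_then_halving[where n = n])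
    have "w \<in> H 0" using w by (simp add: H_def)
    then show "1 \<le> card (H 0)" using finH[of 0] by (auto simp: Suc_le_eq card_gt_0_iff)
    show "card (H j) \<le> card (H (Suc j))" for j
      by (rule card_mono[OF finH]) (use d in \<open>auto simp: H_def algebra_simps\<close>)
    show "2 * card (H j) \<le> card (H (Suc j))" if "j < 2 * l + 1" "1 \<le> card (H j)" "4 * card (H j) \<le> n" for j
    proof -
      have "(card (H j), n + k - 2 * card (H j)) \<in> critical_sizes n k"
        using that by (auto simp: critical_sizes_def)
      from separated[OF this that(1)] show ?thesis by auto
    qed
    show "4 * (n + k - card (H (Suc j))) \<le> n" if "j < 2 * l + 1" "n < 4 * card (H j)" for j
    proof -
      have "((n + 3) div 4, max ((n + 3) div 4) k) \<in> critical_sizes n k"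
        by (auto simp: critical_sizes_def)
      \<comment> \<open>The complement of \<open>H (Suc j)\<close> has at least \<open>k\<close>
        elements because \<open>H (Suc j)\<close> has at most \<open>n\<close>; so being below the
        maximum means being below \<open>(n + 3) div 4\<close>, which is \<open>n / 4\<close>
        rounded up.\<close>
      from separated[OF this that(1)] show ?thesis
        using that cardHn[of "Suc j"] by auto
    qed
    show "2 * (n + k - card (H (Suc j))) \<le> n + k - card (H j)"
      if "j < 2 * l + 1" "4 * (n + k - card (H (Suc j))) \<le> n" for j
    proof -
      let ?t = "n + k - card (H (Suc j))"
      \<comment> \<open>Again \<open>k \<le> ?t\<close>, because \<open>H (Suc j)\<close> has at
        most \<open>n\<close> elements; this is why the third family may start at
        \<open>k\<close>.\<close>
      have "(n - 2 * ?t, ?t) \<in> critical_sizes n k"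
        unfolding critical_sizes_def
        by (intro UnI2 image_eqI[where x = ?t]) (use that cardHn[of "Suc j"] in auto)
      from separated[OF this that(1)] show ?thesis using that by auto
    qed
  qed (use l in auto)
  then show False using cardHn[of "2 * l + 1"] card(3) by simp
qed

text \<open>The critical size with \<open>s = 1\<close> gives every single firm a good worker, whose
  low salary leaves the firm most of the value of the pair.\<close>

lemma core_firm_ge:
  assumes core: "core_allocation F W a \<mu> u v" and fin: "finite F" "finite W"
    and card: "card F = n" "card W = n + k" "4 \<le> n"
    and linked: "\<And>s t. (s, t) \<in> critical_sizes n k \<Longrightarrow> linked F W (\<lambda>f w. 1 - d \<le> a f w) s t"
    and v: "\<And>w. w \<in> W \<Longrightarrow> v w \<le> b" and f: "f \<in> F"
  shows "1 - d - b \<le> u f"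
proof -
  have "(1, n + k - 2) \<in> critical_sizes n k" using card(3) by (auto simp: critical_sizes_def)
  from linkedD[OF linked[OF this], of "{f}" W] f card
  obtain w where "w \<in> W" "1 - d \<le> a f w" by auto
  then show ?thesis using core_pair_ge[OF core fin f] v by (smt (verit))
qed

lemma core_share_le:
  assumes core: "core_allocation F W a \<mu> u v" and fin: "finite F" "finite W" and F: "F \<noteq> {}"
    and v: "\<And>w. w \<in> W \<Longrightarrow> v w \<le> b" and b: "0 \<le> b"
    and u: "\<And>f. f \<in> F \<Longrightarrow> 1 / 2 \<le> u f"
  shows "\<bar>worker_share F W a v\<bar> \<le> 2 * b"
proof -
  have mat: "\<mu> \<subseteq> F \<times> W" "inj_on fst \<mu>" "inj_on snd \<mu>" "matching F W \<mu>"
    and feas: "sum u F + sum v W = matching_value a \<mu>"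
    using core by (auto simp: core_allocation_def allocation_def matching_def)
  have "snd ` \<mu> \<subseteq> W" using mat by auto
  then have "sum v W = sum v (snd ` \<mu>)"
    using core_unmatched_worker[OF core fin] fin(2) by (intro sum.mono_neutral_right) auto
  also have "\<dots> \<le> (\<Sum>w\<in>snd ` \<mu>. b)"
    using \<open>snd ` \<mu> \<subseteq> W\<close> v by (intro sum_mono) auto
  also have "\<dots> = real (card (fst ` \<mu>)) * b"
    using mat by (simp add: card_image)
  also have "\<dots> \<le> real (card F) * b"
    using mat fin b by (intro mult_right_mono of_nat_mono card_mono) auto
  finally have sv: "sum v W \<le> real (card F) * b" .
  have sv0: "0 \<le> sum v W"
    by (rule sum_nonneg) (use core_worker_nonneg[OF core fin] in auto)
  have "real (card F) * (1 / 2) \<le> sum u F"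
    using sum_bounded_below[of F "1 / 2" u] u by simp
  \<comment> \<open>The total payoff equals the value of \<open>\<mu>\<close>, which the total
    surplus dominates.\<close>
  then have val: "real (card F) / 2 \<le> coalition_value a F W"
    using coalition_value_ge[OF fin mat(4), of a] feas sv0 by linarith
  have pos: "0 < real (card F)" using F fin by (simp add: card_gt_0_iff)
  have "sum v W \<le> (real (card F) / 2) * (2 * b)" using sv by simp
  also have "\<dots> \<le> coalition_value a F W * (2 * b)"
    using val b by (intro mult_right_mono) auto
  finally have "sum v W / coalition_value a F W \<le> 2 * b"
    using val pos by (simp add: pos_divide_le_eq mult.commute)
  moreover have "0 \<le> sum v W / coalition_value a F W"
    using sv0 val pos by (intro divide_nonneg_nonneg) auto
  ultimately show ?thesis by (simp add: worker_share_def)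
qed

section \<open>Union bound over empty rectangles\<close>

text \<open>By independence, all \<open>s * t\<close> entries of a fixed rectangle lie below
  \<open>c\<close> with probability at most \<open>exp (- p * s * t)\<close>; the binomial
  coefficients count the rectangles.\<close>

lemma (in prob_space) not_linked:
  fixes X :: "'f \<Rightarrow> 'w \<Rightarrow> 'a \<Rightarrow> real"
  assumes fin: "finite F" "finite W"
    and indep: "indep_vars (\<lambda>_. borel) (\<lambda>(f, w). X f w) (F \<times> W)"
    and tail: "\<And>f w. f \<in> F \<Longrightarrow> w \<in> W \<Longrightarrow> prob (X f w -` {..<c} \<inter> space M) \<le> exp (- p)"
    and st: "0 < s" "0 < t"
  defines "B \<equiv> {\<omega> \<in> space M. \<not> linked F W (\<lambda>f w. c \<le> X f w \<omega>) s t}"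
  shows not_linked_event: "B \<in> events"
    and prob_not_linked_le:
      "prob B \<le> real (card F choose s) * real (card W choose t) * exp (- p * (real s * real t))"
proof -
  let ?S = "{S. S \<subseteq> F \<and> card S = s}" and ?T = "{T. T \<subseteq> W \<and> card T = t}"
  define D where "D = (\<lambda>(S, T). \<Inter>(f, w)\<in>S \<times> T. X f w -` {..<c} \<inter> space M)"
  have meas: "X f w -` {..<c} \<inter> space M \<in> events" if "f \<in> F" "w \<in> W" for f w
  proof -
    have "random_variable borel (X f w)"
      using indep that unfolding indep_vars_def by auto
    then show ?thesis by (rule measurable_sets) auto
  qed
  have D: "D e \<in> events \<and> prob (D e) \<le> exp (- p * (real s * real t))" if e: "e \<in> ?S \<times> ?T" for e
  proof -
    obtain S T where ST: "e = (S, T)" "S \<subseteq> F" "T \<subseteq> W" "card S = s" "card T = t"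
      using e by auto
    have finST: "finite (S \<times> T)" using finite_subset[OF ST(2) fin(1)] finite_subset[OF ST(3) fin(2)] by simp
    \<comment> \<open>Positive sizes matter: an intersection over an empty rectangle would be the
      whole type, not an event inside \<open>space M\<close>.\<close>
    have ne: "S \<times> T \<noteq> {}" using ST st by auto
    have "prob (D e) = (\<Prod>x\<in>S \<times> T. prob ((case x of (f, w) \<Rightarrow> X f w) -` {..<c} \<inter> space M))"
      using indep_varsD[OF indep ne finST Sigma_mono[OF ST(2,3)], of "\<lambda>_. {..<c}"]
      by (simp add: D_def ST(1) case_prod_beta del: INT_simps Int_UNIV_left)
    also have "\<dots> \<le> (\<Prod>x\<in>S \<times> T. exp (- p))"
      using ST tail by (intro prod_mono) (auto simp: subset_iff)
    also have "\<dots> = exp (- p * (real s * real t))"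
      using ST by (simp add: card_cartesian_product exp_of_nat_mult[symmetric] mult_ac)
    finally have "prob (D e) \<le> exp (- p * (real s * real t))" .
    moreover have "D e \<in> events"
      unfolding D_def ST(1) case_prod_conv
      by (rule sets.finite_INT[OF finST ne]) (use ST meas in auto)
    ultimately show ?thesis by blast
  qed
  have finI: "finite (?S \<times> ?T)" using fin by auto
  have "B = (\<Union>e\<in>?S \<times> ?T. D e)"
  proof (intro set_eqI iffI)
    fix \<omega> assume "\<omega> \<in> B"
    then obtain S T where ST: "S \<subseteq> F" "T \<subseteq> W" "card S = s" "card T = t" "\<omega> \<in> space M"
        "\<not> (\<exists>f\<in>S. \<exists>w\<in>T. c \<le> X f w \<omega>)"
      unfolding B_def linked_def by blast
    then have "\<omega> \<in> D (S, T)" by (auto simp: D_def not_le)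
    then show "\<omega> \<in> (\<Union>e\<in>?S \<times> ?T. D e)" using ST(1-4) by blast
  next
    fix \<omega> assume "\<omega> \<in> (\<Union>e\<in>?S \<times> ?T. D e)"
    then obtain S T where ST: "S \<subseteq> F" "T \<subseteq> W" "card S = s" "card T = t" "\<omega> \<in> D (S, T)" by auto
    then have lt: "\<forall>f\<in>S. \<forall>w\<in>T. \<omega> \<in> space M \<and> X f w \<omega> < c" by (auto simp: D_def)
    moreover have "S \<noteq> {}" "T \<noteq> {}" using ST st by auto
    ultimately have "\<omega> \<in> space M" by auto
    moreover have "\<not> (\<exists>f\<in>S. \<exists>w\<in>T. c \<le> X f w \<omega>)" using lt by force
    ultimately show "\<omega> \<in> B" using ST by (auto simp: B_def linked_def)
  qed
  note B = this
  show "B \<in> events" unfolding B using finI D by (intro sets.finite_UN) auto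
  have "prob B \<le> (\<Sum>e\<in>?S \<times> ?T. prob (D e))"
    unfolding B using finI D by (intro finite_measure_subadditive_finite) auto
  also have "\<dots> \<le> real (card (?S \<times> ?T)) * exp (- p * (real s * real t))"
    using D by (intro sum_bounded_above) auto
  also have "card (?S \<times> ?T) = (card F choose s) * (card W choose t)"
    using n_subsets[OF fin(1)] n_subsets[OF fin(2)] by (simp add: card_cartesian_product)
  finally show "prob B \<le> real (card F choose s) * real (card W choose t) * exp (- p * (real s * real t))"
    by simp
qed

section \<open>Estimates at the critical sizes\<close>

lemma real_power_eq_exp: "0 < n \<Longrightarrow> real n ^ i = exp (real i * ln (real n))"
  by (simp add: exp_of_nat_mult)

lemma binomial_le_exp:
  assumes "i \<le> n" "0 < n"
  shows "real (n choose i) \<le> exp (real i * ln (real n))"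
  using binomial_le_pow[OF assms(1)] assms(2)
  by (metis of_nat_le_iff of_nat_power real_power_eq_exp)

text \<open>Free of logarithms; meant for the middle size, where both sets are a constant fraction
  of their side.\<close>

lemma binomial_le_exp_size: "real (n choose i) \<le> exp (real n)"
proof -
  have "real (n choose i) \<le> 2 ^ n"
    using binomial_le_pow2[of n i] by (metis of_nat_le_iff of_nat_numeral of_nat_power)
  also have "\<dots> \<le> exp 1 ^ n" using exp_ge_add_one_self[of 1] by (intro power_mono) auto
  also have "\<dots> = exp (real n)" by (simp add: exp_of_nat_mult[symmetric])
  finally show ?thesis .
qed

text \<open>The exponent \<open>80 * ln n * s * t / n\<close> beats the entropy of choosing the two
  sets, with \<open>2 * ln n\<close> to spare. Where a set is nearly a whole side, its small
  complement is counted instead.\<close>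

lemma critical_size_bound:
  assumes n: "1 \<le> ln (real n)" "2 \<le> n" and k: "1 \<le> k" and st: "(s, t) \<in> critical_sizes n k"
  shows "real (n choose s) * real ((n + k) choose t)
           * exp (- (80 * ln (real n) / real n) * (real s * real t)) \<le> 1 / (real n)\<^sup>2"
proof -
  define m where "m = n + k"
  define x where "x = ln (real n)"
  define y where "y = ln (real m)"
  define r where "r = real m / real n"
  have x1: "1 \<le> x" using n by (simp add: x_def)
  have n0: "0 < real n" "0 < n" using n by auto
  have nm: "n \<le> m" by (simp add: m_def)
  have m0: "0 < real m" "0 < m" using nm n0 by auto
  have xy: "x \<le> y" using nm n0 by (simp add: x_def y_def)
  have r1: "1 \<le> r" using nm n0 by (simp add: r_def)
  have m_eq: "real m = r * real n" using n0 by (simp add: r_def)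
  \<comment> \<open>Toward \<open>ln m \<le> (m / n) * ln n\<close>, from
    \<open>ln r \<le> r - 1\<close> and \<open>1 \<le> ln n\<close>. This makes the first family
    work uniformly in \<open>k\<close>.\<close>
  have "y = x + ln r" using n0 r1 by (simp add: y_def x_def m_eq ln_mult)
  also have "\<dots> \<le> x + (r - 1)" using ln_le_minus_one[of r] r1 by linarith
  also have "\<dots> \<le> x + x * (r - 1)" using mult_right_mono[OF x1, of "r - 1"] r1 by simp
  finally have yr: "y \<le> x * r" by (simp add: algebra_simps)
  have target: "1 / (real n)\<^sup>2 = exp (- (2 * x))"
  proof -
    have "exp (2 * x) = (real n)\<^sup>2"
      using real_power_eq_exp[OF n0(2), of 2] by (simp add: x_def)
    then show ?thesis by (simp add: exp_minus inverse_eq_divide)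
  qed
  have combine: ?thesis
    if "real (n choose s) \<le> exp A" "real (m choose t) \<le> exp B"
      "A + B + 2 * x \<le> 80 * x / real n * (real s * real t)" for A B
  proof -
    have "real (n choose s) * real (m choose t) * exp (- (80 * x / real n) * (real s * real t))
        \<le> exp A * exp B * exp (- (80 * x / real n) * (real s * real t))"
      using that by (intro mult_right_mono mult_mono) auto
    also have "\<dots> = exp (A + B + - (80 * x / real n) * (real s * real t))"
      by (simp only: exp_add)
    also have "\<dots> \<le> exp (- (2 * x))" using that(3) by simp
    finally show ?thesis unfolding target m_def x_def .
  qed
  from st consider
      (small) "1 \<le> s" "4 * s \<le> n" "t = m - 2 * s"
    | (middle) "s = (n + 3) div 4" "t = max ((n + 3) div 4) k"
    | (large) "k \<le> t" "4 * t \<le> n" "s = n - 2 * t"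
    unfolding critical_sizes_def m_def by fastforce
  then show ?thesis
  proof cases
    case small
    have s1: "1 \<le> real s" using small by simp
    have "0 \<le> y" using xy x1 by linarith
    from mult_right_mono[OF s1 this] have ys: "y \<le> real s * y" by simp
    have tm: "real m / 2 \<le> real t" using small nm by (simp add: of_nat_diff)
    have "m choose t = m choose (2 * s)"
      using small nm binomial_symmetric[of "2 * s" m] by simp
    then have 2: "real (m choose t) \<le> exp (real (2 * s) * y)"
      using binomial_le_exp[of "2 * s" m] small nm m0 by (simp add: y_def)
    have 1: "real (n choose s) \<le> exp (real s * x)"
      using binomial_le_exp[of s n] small n0 by (simp add: x_def)
    have "real s * x + real (2 * s) * y + 2 * x \<le> real s * y + 2 * (real s * y) + 2 * (real s * y)"
    proof -
      have "real s * x \<le> real s * y" using xy s1 by (intro mult_left_mono) auto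
      moreover have "x \<le> real s * y" using xy ys by linarith
      moreover have "real (2 * s) * y = 2 * (real s * y)" by simp
      ultimately show ?thesis by linarith
    qed
    also have "\<dots> \<le> 40 * (real s * y)" using s1 xy x1 by simp
    also have "\<dots> \<le> 40 * (real s * (x * r))" using yr s1 by simp
    also have "\<dots> = 80 * x / real n * (real s * (real m / 2))" by (simp add: r_def)
    also have "\<dots> \<le> 80 * x / real n * (real s * real t)"
      using tm x1 n0 by (intro mult_left_mono) auto
    finally show ?thesis by (rule combine[OF 1 2])
  next
    case middle
    have s4: "real n / 4 \<le> real s" using middle by linarith
    \<comment> \<open>Four copies of \<open>t\<close> cover \<open>n\<close> and a fifth covers
      \<open>k\<close>.\<close>
    have "m \<le> 5 * t" using middle by (auto simp: m_def)
    then have t5: "real m / 5 \<le> real t" by linarith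
    have m1: "1 \<le> real m" using m0 by linarith
    have "real n + real m + 2 * x \<le> 2 * real m + 2 * x" using nm by simp
    also have "\<dots> \<le> 2 * (x * real m) + 2 * (x * real m)"
      using mult_right_mono[OF x1, of "real m"] mult_left_mono[OF m1, of x] x1 by linarith
    \<comment> \<open>The constant 80 is fixed here: \<open>80 / (4 * 5) = 4\<close>. The other two
      cases leave room.\<close>
    also have "\<dots> = 80 * x / real n * (real n / 4 * (real m / 5))" using n0 by simp
    also have "\<dots> \<le> 80 * x / real n * (real s * real t)"
      using s4 t5 x1 n0 by (intro mult_left_mono mult_mono) auto
    finally show ?thesis by (rule combine[OF binomial_le_exp_size binomial_le_exp_size])
  next
    case large
    have t1: "1 \<le> real t" using large k by simp
    have sn: "real n / 2 \<le> real s" using large by (simp add: of_nat_diff)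
    have "n choose s = n choose (2 * t)"
      using large binomial_symmetric[of "2 * t" n] by simp
    then have 1: "real (n choose s) \<le> exp (real (2 * t) * x)"
      using binomial_le_exp[of "2 * t" n] large n0 by (simp add: x_def)
    have 2: "real (m choose t) \<le> exp (real t * y)"
      using binomial_le_exp[of t m] large nm m0 by (simp add: y_def)
    \<comment> \<open>In this family \<open>k \<le> t \<le> n / 4\<close>, so \<open>ln m\<close> is
      comparable to \<open>ln n\<close>.\<close>
    have "m \<le> n * n"
    proof -
      have "m \<le> 2 * n" using large k by (simp add: m_def)
      then show ?thesis using mult_right_mono[OF n(2), of n] by (meson le0 order_trans)
    qed
    then have "y \<le> ln (real n * real n)"
      unfolding y_def using m0 by (intro ln_mono) (auto simp flip: of_nat_mult)
    then have y2: "y \<le> 2 * x" using n0 by (simp add: ln_mult x_def)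
    have "real t * y \<le> real t * (2 * x)" using y2 t1 by (intro mult_left_mono) auto
    moreover have "x \<le> real t * x" using mult_right_mono[OF t1, of x] x1 by simp
    moreover have "real (2 * t) * x = 2 * (real t * x)" "real t * (2 * x) = 2 * (real t * x)" by simp_all
    ultimately have "real (2 * t) * x + real t * y + 2 * x \<le> 40 * (real t * x)"
      using x1 by linarith
    also have "\<dots> = 80 * x / real n * (real n / 2 * real t)" using n0 by simp
    also have "\<dots> \<le> 80 * x / real n * (real s * real t)"
      using sn x1 n0 by (intro mult_left_mono mult_right_mono) auto
    finally show ?thesis by (rule combine[OF 1 2])
  qed
qed

lemma critical_size_pos:
  assumes "(s, t) \<in> critical_sizes n k" "2 \<le> n" "1 \<le> k"
  shows "0 < s" "0 < t"
  using assms by (auto simp: critical_sizes_def)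

section \<open>Tails of the entries and probability of expansion\<close>

context prob_space
begin

text \<open>The density vanishes above 1 and is at least \<open>c\<close> on an interval of length
  \<open>d\<close> below 1; then \<open>1 - x \<le> exp (- x)\<close>.\<close>

lemma
  fixes X :: "'a \<Rightarrow> real" and g :: "real \<Rightarrow> real"
  assumes X: "distributed M lborel X (\<lambda>x. ennreal (g x) * indicator {0..1} x)"
  shows distributed_unit_interval_gt_1: "prob (X -` {1<..} \<inter> space M) = 0"
    and distributed_unit_interval_tail:
      "(\<And>x. x \<in> {0..1} \<Longrightarrow> c \<le> g x) \<Longrightarrow> 0 \<le> c \<Longrightarrow> 0 \<le> d \<Longrightarrow> d \<le> 1
        \<Longrightarrow> prob (X -` {..<1 - d} \<inter> space M) \<le> exp (- (c * d))"
proof -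
  have rv: "random_variable borel X" using distributed_measurable[OF X] by simp
  have "emeasure M (X -` {1<..} \<inter> space M) = (\<integral>\<^sup>+x. ennreal (g x) * indicator {0..1} x * indicator {1<..} x \<partial>lborel)"
    by (rule distributed_emeasure[OF X]) auto
  also have "\<dots> = (\<integral>\<^sup>+x. 0 \<partial>(lborel :: real measure))"
    by (rule nn_integral_cong) (auto simp: indicator_def)
  finally show "prob (X -` {1<..} \<inter> space M) = 0" by (simp add: measure_def)
  assume c: "\<And>x. x \<in> {0..1} \<Longrightarrow> c \<le> g x" "0 \<le> c" and d: "0 \<le> d" "d \<le> 1"
  let ?A = "X -` {1 - d..} \<inter> space M"
  have "ennreal (c * d) = (\<integral>\<^sup>+x. ennreal c * indicator {1 - d..1} x \<partial>lborel)"
    using c d by (simp add: nn_integral_cmult ennreal_mult)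
  also have "\<dots> \<le> (\<integral>\<^sup>+x. ennreal (g x) * indicator {0..1} x * indicator {1 - d..} x \<partial>lborel)"
    using c d by (intro nn_integral_mono) (auto simp: indicator_def ennreal_leI)
  also have "\<dots> = emeasure M ?A"
    by (rule distributed_emeasure[OF X, symmetric]) auto
  finally have ge: "c * d \<le> prob ?A"
    by (simp add: emeasure_eq_measure)
  have A: "?A \<in> events" using rv by (rule measurable_sets) auto
  have "X -` {..<1 - d} \<inter> space M = space M - ?A" by auto
  then have "prob (X -` {..<1 - d} \<inter> space M) = 1 - prob ?A" using prob_compl[OF A] by simp
  also have "\<dots> \<le> 1 + - (c * d)" using ge by simp
  also have "\<dots> \<le> exp (- (c * d))" by (rule exp_ge_add_one_self)
  finally show "prob (X -` {..<1 - d} \<inter> space M) \<le> exp (- (c * d))" .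
qed

end

text \<open>A density bounds the entries by 1 only almost surely, while the core argument uses the
  bound at each outcome; so it is made part of the event.\<close>

definition linked_event ::
    "'a measure \<Rightarrow> 'f set \<Rightarrow> 'w set \<Rightarrow> ('f \<Rightarrow> 'w \<Rightarrow> 'a \<Rightarrow> real) \<Rightarrow> real \<Rightarrow> (nat \<times> nat) set \<Rightarrow> 'a set" where
  "linked_event M F W X d Z = {\<omega> \<in> space M. (\<forall>f\<in>F. \<forall>w\<in>W. X f w \<omega> \<le> 1) \<and>
     (\<forall>(s, t)\<in>Z. linked F W (\<lambda>f w. 1 - d \<le> X f w \<omega>) s t)}"

lemma linked_event_measurable:
  fixes X :: "'f \<Rightarrow> 'w \<Rightarrow> 'a \<Rightarrow> real"
  assumes fin: "finite F" "finite W" "finite Z"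
    and X: "\<And>f w. f \<in> F \<Longrightarrow> w \<in> W \<Longrightarrow> X f w \<in> borel_measurable M"
  shows "linked_event M F W X d Z \<in> sets M"
proof -
  \<comment> \<open>Bounded quantifiers over finite families exhibit the event as a finite Boolean
    combination of measurable conditions.\<close>
  have *: "linked F W R s t \<longleftrightarrow> (\<forall>S\<in>{S. S \<subseteq> F \<and> card S = s}. \<forall>T\<in>{T. T \<subseteq> W \<and> card T = t}. \<exists>f\<in>S. \<exists>w\<in>T. R f w)"
    for R and s t by (auto simp: linked_def)
  have f: "finite {S. S \<subseteq> F \<and> card S = i}" "finite {T. T \<subseteq> W \<and> card T = i}" for i
    using fin by auto
  have sub: "finite S" "finite T" if "S \<subseteq> F" "T \<subseteq> W" for S T
    using that fin finite_subset by blast+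
  have "{\<omega> \<in> space M. X f w \<omega> \<le> 1} \<in> sets M" "{\<omega> \<in> space M. 1 - d \<le> X f w \<omega>} \<in> sets M"
    if "f \<in> F" "w \<in> W" for f w
    using X[OF that] by measurable
  then show ?thesis
    unfolding linked_event_def * case_prod_beta
    by (intro sets.sets_Collect_conj sets.sets_Collect_finite_All sets.sets_Collect_finite_Ex fin f)
      (auto simp: subset_iff intro: sub)
qed

text \<open>The complement is covered by at most \<open>n\<close> failures of linking, each of
  probability at most \<open>1 / n^2\<close>, and finitely many null sets. The choice of
  \<open>d\<close> makes \<open>c * d\<close> the rate in
  \<open>critical_size_bound\<close>.\<close>

lemma (in prob_space) linked_event_prob:
  fixes X :: "'f \<Rightarrow> 'w \<Rightarrow> 'a \<Rightarrow> real"
  assumes fin: "finite F" "finite W" and card: "card F = n" "card W = n + k"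
    and n: "1 \<le> ln (real n)" "2 \<le> n" "1 \<le> k"
    and indep: "indep_vars (\<lambda>_. borel) (\<lambda>(f, w). X f w) (F \<times> W)"
    and distr: "\<And>f w. f \<in> F \<Longrightarrow> w \<in> W \<Longrightarrow>
       distributed M lborel (X f w) (\<lambda>x. ennreal (g x) * indicator {0..1} x)"
    and g: "\<And>x. x \<in> {0..1} \<Longrightarrow> c \<le> g x" "0 < c"
    and d: "d = 80 * ln (real n) / (c * real n)" "d \<le> 1"
  shows "1 - prob (linked_event M F W X d (critical_sizes n k)) \<le> 1 / real n"
proof -
  let ?Z = "critical_sizes n k"
  let ?E = "linked_event M F W X d ?Z"
  let ?B = "\<lambda>(s, t). {\<omega> \<in> space M. \<not> linked F W (\<lambda>f w. 1 - d \<le> X f w \<omega>) s t}"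
  let ?C = "\<lambda>(f, w). X f w -` {1<..} \<inter> space M"
  have rv: "random_variable borel (X f w)" if "f \<in> F" "w \<in> W" for f w
    using distributed_measurable[OF distr[OF that]] by simp
  have E: "?E \<in> events"
    by (rule linked_event_measurable[OF fin finite_critical_sizes rv])
  have d0: "0 \<le> d" using d n g by simp
  have cd: "c * d = 80 * ln (real n) / real n" using d g by simp
  have tail: "prob (X f w -` {..<1 - d} \<inter> space M) \<le> exp (- (80 * ln (real n) / real n))"
    if "f \<in> F" "w \<in> W" for f w
    using distributed_unit_interval_tail[OF distr[OF that] g(1), of d] g(2) d0 d(2) cd by simp
  have B: "?B e \<in> events \<and> prob (?B e) \<le> 1 / (real n)\<^sup>2" if "e \<in> ?Z" for e
  proof -
    obtain s t where e: "e = (s, t)" by force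
    note pos = critical_size_pos[OF that[unfolded e] n(2,3)]
    show ?thesis
      using not_linked_event[OF fin indep tail pos] prob_not_linked_le[OF fin indep tail pos]
        critical_size_bound[OF n that[unfolded e]] card e by simp
  qed
  have C: "?C e \<in> events \<and> prob (?C e) = 0" if "e \<in> F \<times> W" for e
    using that rv distributed_unit_interval_gt_1[OF distr] by (auto intro: measurable_sets)
  have finC: "finite (F \<times> W)" using fin by simp
  have U: "(\<Union>e\<in>?Z. ?B e) \<in> events" "(\<Union>e\<in>F \<times> W. ?C e) \<in> events"
    using B C finC finite_critical_sizes by (auto intro!: sets.finite_UN)
  have "1 - prob ?E = prob (space M - ?E)" using prob_compl[OF E] by simp
  also have "\<dots> \<le> prob ((\<Union>e\<in>?Z. ?B e) \<union> (\<Union>e\<in>F \<times> W. ?C e))"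
    by (rule finite_measure_mono) (use U in \<open>auto simp: linked_event_def not_le\<close>)
  also have "\<dots> \<le> prob (\<Union>e\<in>?Z. ?B e) + prob (\<Union>e\<in>F \<times> W. ?C e)"
    by (rule measure_Un_le[OF U])
  also have "prob (\<Union>e\<in>?Z. ?B e) \<le> (\<Sum>e\<in>?Z. prob (?B e))"
    using B finite_critical_sizes by (intro finite_measure_subadditive_finite) blast+
  also have "\<dots> \<le> real (card ?Z) * (1 / (real n)\<^sup>2)"
    using B by (intro sum_bounded_above) blast
  also have "\<dots> \<le> real n * (1 / (real n)\<^sup>2)"
    using card_critical_sizes_le[OF n(2,3)] by (intro mult_right_mono) auto
  also have "\<dots> = 1 / real n" by (simp add: power2_eq_square)
  also have "prob (\<Union>e\<in>F \<times> W. ?C e) \<le> (\<Sum>e\<in>F \<times> W. prob (?C e))"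
    using C finC by (intro finite_measure_subadditive_finite) blast+
  also have "\<dots> = 0" using C by (intro sum.neutral) blast
  finally show ?thesis by simp
qed

section \<open>Number of steps, constants and asymptotics\<close>

text \<open>For the least such \<open>l\<close>, \<open>2 ^ (l - 1) \<le> n\<close> and
  \<open>1 / 2 \<le> ln 2\<close> give \<open>2 * l + 1 \<le> 4 * ln n + 3\<close>; the 3 is
  absorbed by \<open>1 \<le> ln n\<close>.\<close>

lemma ex_power_two_gt:
  assumes "1 \<le> ln (real n)"
  shows "\<exists>l. n < 2 ^ l \<and> real (2 * l + 1) \<le> 7 * ln (real n)"
proof -
  define l where "l = (LEAST l. n < 2 ^ l)"
  have l: "n < 2 ^ l" unfolding l_def by (rule LeastI[of _ n]) (rule less_exp)
  have n0: "0 < n" using assms by (cases n) auto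
  then have "l \<noteq> 0" using l by (cases l) auto
  then obtain i where i: "l = Suc i" by (cases l) auto
  have "\<not> n < 2 ^ i" using not_less_Least[of i "\<lambda>l. n < 2 ^ l"] i by (simp add: l_def[symmetric])
  then have "(2 :: real) ^ i \<le> real n" by (metis not_le of_nat_le_iff of_nat_numeral of_nat_power)
  then have "ln ((2 :: real) ^ i) \<le> ln (real n)" using n0 by (intro ln_mono) auto
  then have "real i * ln 2 \<le> ln (real n)" by (simp add: ln_realpow)
  moreover have "real i * (1 / 2) \<le> real i * ln 2"
    using ln2_ge_two_thirds by (intro mult_left_mono) auto
  ultimately have "real i \<le> 2 * ln (real n)" by simp
  then show ?thesis using l i assms by (intro exI[of _ l]) auto
qed

theorem corollary9:
  fixes M :: "nat \<Rightarrow> 'a measure"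
    and F :: "nat \<Rightarrow> 'f set"
    and W :: "nat \<Rightarrow> 'w set"
    and k :: "nat \<Rightarrow> nat"
    and \<alpha> :: "nat \<Rightarrow> 'f \<Rightarrow> 'w \<Rightarrow> 'a \<Rightarrow> real"
    and g :: "real \<Rightarrow> real"
  assumes "\<And>n. n \<ge> 1 \<Longrightarrow> prob_space (M n)"
    and "\<And>n. n \<ge> 1 \<Longrightarrow> finite (F n) \<and> card (F n) = n"
    and "\<And>n. n \<ge> 1 \<Longrightarrow> finite (W n) \<and> card (W n) = n + k n"
    and "\<And>n. n \<ge> 1 \<Longrightarrow> k n \<ge> 1"
    and "continuous_on {0..1} g"
    and "\<And>x. x \<in> {0..1} \<Longrightarrow> g x > 0"
    and "\<And>n. n \<ge> 1 \<Longrightarrow>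
           prob_space.indep_vars (M n) (\<lambda>_. borel) (\<lambda>(f, w). \<alpha> n f w) (F n \<times> W n)"
    and "\<And>n f w. n \<ge> 1 \<Longrightarrow> f \<in> F n \<Longrightarrow> w \<in> W n \<Longrightarrow>
           distributed (M n) lborel (\<alpha> n f w) (\<lambda>x. ennreal (g x) * indicator {0..1} x)"
  shows "\<exists>C E.
     (\<forall>n\<ge>1. E n \<in> sets (M n)) \<and>
     (\<lambda>n. 1 - measure (M n) (E n)) \<in> O(\<lambda>n. 1 / real n) \<and>
     (\<forall>\<^sub>F n in sequentially. \<forall>\<omega>\<in>E n. \<forall>\<mu> u v.
        core_allocation (F n) (W n) (\<lambda>f w. \<alpha> n f w \<omega>) \<mu> u v \<longrightarrow>
          (\<forall>w\<in>W n. \<bar>v w\<bar> \<le> C * ((ln (real n))\<^sup>2 / real n)) \<and>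
          \<bar>worker_share (F n) (W n) (\<lambda>f w. \<alpha> n f w \<omega>) v\<bar> \<le> C * ((ln (real n))\<^sup>2 / real n))"
proof -
  \<comment> \<open>Compactness gives the density a positive minimum.\<close>
  obtain z where z: "z \<in> {0..1}" "\<forall>x\<in>{0..1}. g z \<le> g x"
    using continuous_attains_inf[of "{0..1 :: real}" g] assms(5) by auto
  define c where "c = g z"
  have c0: "0 < c" and cg: "\<And>x. x \<in> {0..1} \<Longrightarrow> c \<le> g x"
    using z assms(6) by (auto simp: c_def)
  define d where "d n = 80 * ln (real n) / (c * real n)" for n :: nat
  define E where "E n = linked_event (M n) (F n) (W n) (\<alpha> n) (d n) (critical_sizes n (k n))" for n
  define rate where "rate n = (ln (real n))\<^sup>2 / real n" for n :: nat
  have ev_ln: "\<forall>\<^sub>F n in sequentially. 1 \<le> ln (real n)" by real_asymp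
  \<comment> \<open>Here \<open>640 = 80 * 8\<close>, where \<open>8 * ln n\<close> bounds
    \<open>2 * l + 2\<close>, the number of steps plus one. The value \<open>1 / 2\<close> yields
    both \<open>d n \<le> 1\<close> and profits of at least \<open>1 / 2\<close>.\<close>
  have ev_rate: "\<forall>\<^sub>F n in sequentially. 640 / c * rate n \<le> 1 / 2"
  proof -
    have "(\<lambda>n. 640 / c * rate n) \<longlonglongrightarrow> 640 / c * 0"
      unfolding rate_def by (intro tendsto_mult tendsto_const) real_asymp
    then have "\<forall>\<^sub>F n in sequentially. 640 / c * rate n < 1 / 2"
      by (intro order_tendstoD(2)) auto
    then show ?thesis by eventually_elim simp
  qed
  have steps: "x * d n \<le> 80 * b / c * rate n" if "x \<le> b * ln (real n)" "1 \<le> ln (real n)" for x b n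
  proof -
    have "x * d n \<le> b * ln (real n) * d n"
      using that c0 by (intro mult_right_mono) (auto simp: d_def)
    then show ?thesis by (simp add: d_def rate_def power2_eq_square mult_ac)
  qed
  have E_sets: "E n \<in> sets (M n)" if n: "1 \<le> n" for n
    unfolding E_def
    using assms(2,3)[OF n] distributed_measurable[OF assms(8)[OF n]] finite_critical_sizes
    by (intro linked_event_measurable) auto
  have E_prob: "(\<lambda>n. 1 - measure (M n) (E n)) \<in> O(\<lambda>n. 1 / real n)"
  proof (rule bigoI[where c = 1])
    show "\<forall>\<^sub>F n in sequentially. norm (1 - measure (M n) (E n)) \<le> 1 * norm (1 / real n)"
      using ev_ln ev_rate eventually_ge_at_top[of 2]
    proof eventually_elim
      case (elim n)
      then have n1: "1 \<le> n" by simp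
      interpret prob_space "M n" using assms(1)[OF n1] .
      have "1 * d n \<le> 640 / c * rate n" using steps[of 1 8 n] elim by simp
      then have "d n \<le> 1" using elim by simp
      then have "1 - prob (E n) \<le> 1 / real n"
        unfolding E_def
        using assms(2,3)[OF n1] assms(4,7,8)[OF n1] elim cg c0
        by (intro linked_event_prob[where g = g and c = c]) (auto simp: d_def)
      then show ?case by simp
    qed
  qed
  have bounds: "(\<forall>w\<in>W n. \<bar>v w\<bar> \<le> 1280 / c * rate n) \<and>
        \<bar>worker_share (F n) (W n) (\<lambda>f w. \<alpha> n f w \<omega>) v\<bar> \<le> 1280 / c * rate n"
    if n: "1 \<le> ln (real n)" "640 / c * rate n \<le> 1 / 2" "4 \<le> n" and \<omega>: "\<omega> \<in> E n"
      and core: "core_allocation (F n) (W n) (\<lambda>f w. \<alpha> n f w \<omega>) \<mu> u v" for n \<omega> \<mu> u v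
  proof -
    have n1: "1 \<le> n" using n by simp
    have fin: "finite (F n)" "finite (W n)" and card: "card (F n) = n" "card (W n) = n + k n"
      using assms(2,3)[OF n1] by auto
    have lk: "linked (F n) (W n) (\<lambda>f w. 1 - d n \<le> \<alpha> n f w \<omega>) s t" if "(s, t) \<in> critical_sizes n (k n)" for s t
      using \<omega> that by (auto simp: E_def linked_event_def)
    have le1: "\<alpha> n f w \<omega> \<le> 1" if "f \<in> F n" "w \<in> W n" for f w
      using \<omega> that by (auto simp: E_def linked_event_def)
    have d0: "0 \<le> d n" using n c0 by (simp add: d_def)
    obtain l where l: "n < 2 ^ l" "real (2 * l + 1) \<le> 7 * ln (real n)"
      using ex_power_two_gt[OF n(1)] by blast
    define b where "b = real (2 * l + 1) * d n"
    have v: "v w \<le> b" if "w \<in> W n" for w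
      unfolding b_def using core_worker_le[OF core fin card assms(4)[OF n1] le1 lk d0 l(1) that] .
    have b0: "0 \<le> b" unfolding b_def using d0 by simp
    \<comment> \<open>The extra \<open>d n\<close> is the loss of a firm in a good pair.\<close>
    have "b + d n = (real (2 * l + 1) + 1) * d n" by (simp add: b_def algebra_simps)
    also have "\<dots> \<le> 640 / c * rate n" using steps[of "real (2 * l + 1) + 1" 8 n] l n by simp
    finally have bd: "b + d n \<le> 640 / c * rate n" .
    have "1 / 2 \<le> u f" if "f \<in> F n" for f
      using core_firm_ge[OF core fin card n(3) lk v that] bd n(2) by simp
    then have share: "\<bar>worker_share (F n) (W n) (\<lambda>f w. \<alpha> n f w \<omega>) v\<bar> \<le> 2 * b"
      using card n v b0 by (intro core_share_le[OF core fin]) auto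
    \<comment> \<open>The share bound \<open>2 * b\<close> doubles 640 to the final constant
      1280.\<close>
    have b2: "2 * b \<le> 1280 / c * rate n" using bd d0 by simp
    have "\<bar>v w\<bar> \<le> 2 * b" if "w \<in> W n" for w
      using v[OF that] core_worker_nonneg[OF core fin that] b0 by simp
    then show ?thesis using share b2 by (meson order_trans)
  qed
  have "\<forall>\<^sub>F n in sequentially. \<forall>\<omega>\<in>E n. \<forall>\<mu> u v.
        core_allocation (F n) (W n) (\<lambda>f w. \<alpha> n f w \<omega>) \<mu> u v \<longrightarrow>
          (\<forall>w\<in>W n. \<bar>v w\<bar> \<le> 1280 / c * rate n) \<and>
          \<bar>worker_share (F n) (W n) (\<lambda>f w. \<alpha> n f w \<omega>) v\<bar> \<le> 1280 / c * rate n"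
    using ev_ln ev_rate eventually_ge_at_top[of 4]
    by eventually_elim (use bounds in blast)
  with E_sets E_prob show ?thesis unfolding rate_def by blast
qed

end
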